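(* Let $m\geq 4$ be even. There exists a constant $C_m>0$ (depending only on $m$) such that for all integers $n\ge 1$ $$ r_3(\mathbb{Z}_m^n) \geq \frac{C_m}{\sqrt{n}}\left(\frac{m+2}{2}\right)^n.$$ With $\sigma_m = \sqrt{\frac{m^4+8m^3+4m^2-48m}{2880}}$ one can choose $C_m=\frac{1}{3\sqrt{3}\,\sigma_m}$. With this choice, as $m\to\infty$ through even values, $C_m \sim \frac{8 \sqrt{5}}{\sqrt{3}\, m^2}$.
   Context: $\mathbb{Z}_m^n$ denotes the additive group $(\mathbb{Z}/m\mathbb{Z})^n$. A proper arithmetic progression of length $k$ in $\mathbb{Z}_m^n$ is a sequence $x, x+d, \ldots, x+(k-1)d$ (with $x,d\in\mathbb{Z}_m^n$) whose $k$ elements are pairwise distinct. $r_k(\mathbb{Z}_m^n)$ denotes the maximal size of a set $S\subseteq\mathbb{Z}_m^n$ that does not contain a proper arithmetic progression of length $k$. *)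

theory Defs
  imports Complex_Main "HOL-Algebra.Product_Groups" "HOL-Library.Landau_Symbols"
begin

text \<open>HOL-Algebra writes groups multiplicatively, so \<open>x \<otimes> d [^] j\<close> below is
  the term \<open>x + j d\<close> of a progression.\<close>

definition proper_ap :: "('a, 'b) monoid_scheme \<Rightarrow> nat \<Rightarrow> 'a list \<Rightarrow> bool" where
  "proper_ap G k xs \<longleftrightarrow>
     (\<exists>x\<in>carrier G. \<exists>d\<in>carrier G. xs = map (\<lambda>j. x \<otimes>\<^bsub>G\<^esub> d [^]\<^bsub>G\<^esub> j) [0..<k]) \<and> distinct xs"

definition proper_ap_free :: "('a, 'b) monoid_scheme \<Rightarrow> nat \<Rightarrow> 'a set \<Rightarrow> bool" where
  "proper_ap_free G k S \<longleftrightarrow> \<not> (\<exists>xs. proper_ap G k xs \<and> set xs \<subseteq> S)"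

text \<open>Only meaningful for a finite carrier and \<open>k \<ge> 1\<close>; otherwise the \<open>Max\<close> may range over an
  infinite or empty set.\<close>

definition r_ap :: "nat \<Rightarrow> ('a, 'b) monoid_scheme \<Rightarrow> nat" where
  "r_ap k G = Max {card S | S. S \<subseteq> carrier G \<and> proper_ap_free G k S}"

definition Zmod_power :: "nat \<Rightarrow> nat \<Rightarrow> (nat \<Rightarrow> int) monoid" where
  "Zmod_power m n = product_group {..<n} (\<lambda>_. integer_mod_group m)"

definition sigma :: "nat \<Rightarrow> real" where
  "sigma m = sqrt ((real m ^ 4 + 8 * real m ^ 3 + 4 * real m ^ 2 - 48 * real m) / 2880)"

end

theory Submission
  imports Defs "HOL-Real_Asymp.Real_Asymp"
begin

text \<open>Let \<open>h = m/2\<close>. If \<open>x + z \<equiv> 2y (mod m)\<close> with \<open>x, y, z \<in> {0..h}\<close>, then either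
  \<open>x + z = 2y\<close> or \<open>(x, y, z)\<close> is one of \<open>(0, h, 0)\<close>, \<open>(h, 0, h)\<close>. The strictly concave function
  \<open>t(h - t)\<close> takes the same value at \<open>0\<close> and \<open>h\<close>, so a level set of \<open>\<Sum>i. x i (h - x i)\<close> in
  \<open>{0..h}^n\<close> contains no proper progression of length 3. The variance of \<open>t(h - t)\<close> for uniform
  \<open>t\<close> is \<open>\<sigma>\<^sub>m\<^sup>2\<close>. A popular level is found by summing the weight \<open>1 - (s - \<mu>)\<^sup>2 / (3V)\<close>, with
  \<open>V = n \<sigma>\<^sub>m\<^sup>2\<close>, over all points: its average is \<open>2/3\<close>, while over the integers \<open>s\<close> where it is
  nonnegative it adds up to less than \<open>2 sqrt (3V)\<close>. Using this weight instead of Chebyshev's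
  inequality avoids the rounding loss in counting the integers of an interval, so that the constant
  \<open>1 / (3 sqrt 3 \<sigma>\<^sub>m)\<close> holds for every \<open>n\<close>.\<close>

section \<open>Quadratic weights on integer intervals\<close>

text \<open>Squared deviations of equally spaced points are smallest about their midpoint. The exact
  excess is the square term in the identity, which measures how far \<open>\<mu>\<close> is from
  that midpoint.\<close>

lemma sum_sq_dev_int_ge:
  fixes a \<mu> :: real
  shows "(\<Sum>j<K. (a + real j - \<mu>)\<^sup>2) \<ge> real K * ((real K)\<^sup>2 - 1) / 12"
proof -
  have "12 * (\<Sum>j<K. (a + real j - \<mu>)\<^sup>2) =
      real K * ((real K)\<^sup>2 - 1) + 3 * real K * (2 * (a - \<mu>) + (real K - 1))\<^sup>2"
    by (induction K) (simp_all add: power2_eq_square algebra_simps)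
  moreover have "3 * real K * (2 * (a - \<mu>) + (real K - 1))\<^sup>2 \<ge> 0"
    by simp
  ultimately show ?thesis by linarith
qed

lemma cubic_weight_bound:
  fixes L k :: real
  assumes "L > 0" "L\<^sup>2 \<ge> 2/3" "k \<ge> 0"
  shows "k - k * (k\<^sup>2 - 1) / (12 * L\<^sup>2) < 2 * L"
proof -
  \<comment> \<open>A double zero at \<open>k = 9/4 L\<close>, close to where the left-hand side of the claim peaks.\<close>
  have "0 \<le> (4 * k - 9 * L)\<^sup>2 * (4 * k + 18 * L)"
    using assms by (intro mult_nonneg_nonneg) auto
  also have "\<dots> = 64 * k ^ 3 - 972 * (L\<^sup>2 * k) + 1458 * L ^ 3"
    by (simp add: eval_nat_numeral algebra_simps)
  finally have "972 * (L\<^sup>2 * k) \<le> 64 * k ^ 3 + 1458 * L ^ 3" by simp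
  \<comment> \<open>The lower-order term \<open>k\<close>, which comes from discreteness, is
    absorbed into \<open>L\<^sup>2 * k\<close>.\<close>
  moreover have "2/3 * k \<le> L\<^sup>2 * k"
    using assms by (intro mult_right_mono) auto
  moreover have "L\<^sup>2 * k \<ge> 0" "L ^ 3 > 0" using assms by auto
  ultimately have "12 * L\<^sup>2 * k - (k ^ 3 - k) < 24 * L ^ 3"
    by linarith
  then have "(12 * L\<^sup>2 * k - (k ^ 3 - k)) / (12 * L\<^sup>2) < 24 * L ^ 3 / (12 * L\<^sup>2)"
    using assms by (intro divide_strict_right_mono) auto
  then show ?thesis
    using assms by (simp add: power2_eq_square power3_eq_cube field_simps)
qed

lemma sum_quadratic_weight_less:
  fixes L \<mu> :: real and a b :: int
  assumes "L > 0" "L\<^sup>2 \<ge> 2/3"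
  shows "(\<Sum>s\<in>{a..b}. 1 - (real_of_int s - \<mu>)\<^sup>2 / L\<^sup>2) < 2 * L"
proof -
  \<comment> \<open>For \<open>b < a\<close> the truncation by \<open>nat\<close> gives
    \<open>K = 0\<close>, matching the empty interval.\<close>
  define K where "K = nat (b - a + 1)"
  have "bij_betw (\<lambda>j. a + int j) {..<K} {a..b}"
    by (rule bij_betwI[where g = "\<lambda>s. nat (s - a)"]) (auto simp: K_def)
  then have "(\<Sum>s\<in>{a..b}. 1 - (real_of_int s - \<mu>)\<^sup>2 / L\<^sup>2) =
      (\<Sum>j<K. 1 - (real_of_int (a + int j) - \<mu>)\<^sup>2 / L\<^sup>2)"
    by (rule sum.reindex_bij_betw[symmetric])
  also have "\<dots> = real K - (\<Sum>j<K. (real_of_int a + real j - \<mu>)\<^sup>2) / L\<^sup>2"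
    by (simp add: sum_subtractf sum_divide_distrib)
  also have "\<dots> \<le> real K - (real K * ((real K)\<^sup>2 - 1) / 12) / L\<^sup>2"
    using sum_sq_dev_int_ge by (intro diff_left_mono divide_right_mono) auto
  also have "\<dots> < 2 * L"
    using cubic_weight_bound[OF assms, of "real K"] by simp
  finally show ?thesis .
qed

section \<open>A popular value from the second moment\<close>

lemma popular_value:
  fixes f :: "'a \<Rightarrow> int" and \<mu> V :: real
  assumes fin: "finite X" and V: "V \<ge> 2/9"
    and var: "(\<Sum>x\<in>X. (real_of_int (f x) - \<mu>)\<^sup>2) = real (card X) * V"
  shows "\<exists>s. real (card X) / (3 * sqrt 3 * sqrt V) \<le> real (card {x\<in>X. f x = s})"
proof (cases "X = {}")
  case False
  \<comment> \<open>For \<open>L\<^sup>2 = c * V\<close> the argument would give the fraction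
    \<open>(1 - 1/c) / (2 * sqrt c * sqrt V)\<close> of \<open>X\<close>, which is largest at
    \<open>c = 3\<close>. The bound \<open>V \<ge> 2/9\<close> then says
    \<open>L\<^sup>2 \<ge> 2/3\<close>.\<close>
  define L where "L = sqrt (3 * V)"
  have L: "L > 0" "L\<^sup>2 = 3 * V" using V by (auto simp: L_def)
  define P where "P = real (card X) / (3 * L)"
  have P: "P > 0" using False fin L by (auto simp: P_def card_gt_0_iff)
  define A where "A = {\<lceil>\<mu> - L\<rceil>..\<lfloor>\<mu> + L\<rfloor>}"
  define w where "w s = 1 - (real_of_int s - \<mu>)\<^sup>2 / L\<^sup>2" for s
  have A: "s \<in> A \<longleftrightarrow> w s \<ge> 0" for s
  proof -
    have "s \<in> A \<longleftrightarrow> \<bar>real_of_int s - \<mu>\<bar> \<le> \<bar>L\<bar>"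
      using L by (auto simp: A_def ceiling_le_iff le_floor_iff)
    also have "\<dots> \<longleftrightarrow> w s \<ge> 0"
      using L(1) unfolding abs_le_square_iff w_def by (simp add: field_simps)
    finally show ?thesis .
  qed
  have "\<exists>s. P \<le> real (card {x\<in>X. f x = s})"
  proof (rule ccontr)
    assume "\<nexists>s. P \<le> real (card {x\<in>X. f x = s})"
    then have less: "real (card {x\<in>X. f x = s}) \<le> P" for s
      by (meson linear)
    have "2/3 * real (card X) = (\<Sum>x\<in>X. w (f x))"
      using L V by (simp add: w_def sum_subtractf var flip: sum_divide_distrib)
    \<comment> \<open>Only negative weights are dropped. Those that remain are nonnegative, so the
      bound on fibre sizes can be multiplied in below.\<close>
    also have "\<dots> \<le> (\<Sum>x\<in>X. if f x \<in> A then w (f x) else 0)"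
      by (intro sum_mono) (auto simp: A)
    also have "\<dots> = (\<Sum>x\<in>{x\<in>X. f x \<in> A}. w (f x))"
      using fin by (simp add: sum.If_cases Int_def)
    also have "\<dots> = (\<Sum>s\<in>A. \<Sum>x\<in>{x\<in>{x\<in>X. f x \<in> A}. f x = s}. w (f x))"
      by (rule sum.group[symmetric]) (use fin in \<open>auto simp: A_def\<close>)
    also have "\<dots> = (\<Sum>s\<in>A. real (card {x\<in>X. f x = s}) * w s)"
    proof (rule sum.cong)
      fix s assume "s \<in> A"
      then have "{x\<in>{x\<in>X. f x \<in> A}. f x = s} = {x\<in>X. f x = s}" by auto
      then show "(\<Sum>x\<in>{x\<in>{x\<in>X. f x \<in> A}. f x = s}. w (f x)) =
          real (card {x\<in>X. f x = s}) * w s" by simp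
    qed simp
    also have "\<dots> \<le> (\<Sum>s\<in>A. P * w s)"
      using less by (intro sum_mono mult_right_mono) (auto simp: A)
    also have "\<dots> < P * (2 * L)"
      unfolding sum_distrib_left[symmetric] w_def A_def using P L V
      by (intro mult_strict_left_mono sum_quadratic_weight_less) auto
    also have "\<dots> = 2/3 * real (card X)"
      using L by (simp add: P_def)
    finally show False by simp
  qed
  then show ?thesis
    by (simp add: P_def L_def real_sqrt_mult mult.assoc)
qed auto

section \<open>Moments of the parabola on a box\<close>

lemma sum_PiE_insert:
  assumes "i \<notin> I"
  shows "(\<Sum>x\<in>PiE (insert i I) (\<lambda>_. D). G x) = (\<Sum>t\<in>D. \<Sum>x\<in>PiE I (\<lambda>_. D). G (x(i := t)))"
proof -
  have "inj_on (\<lambda>(t, x). x(i := t)) (D \<times> PiE I (\<lambda>_. D))"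
    using inj_combinator[OF assms, of "\<lambda>_. D"] by simp
  then show ?thesis
    by (simp add: PiE_insert_eq sum.reindex sum.cartesian_product case_prod_unfold)
qed

text \<open>Variances of independent coordinates add: the cross term \<open>S1\<close> is multiplied
  by the sum of \<open>g\<close> over \<open>D\<close>, which is zero.\<close>

lemma variance_sum_PiE:
  fixes g :: "'b \<Rightarrow> real"
  assumes "finite I" "finite D" and mean: "(\<Sum>t\<in>D. g t) = 0"
    and var: "(\<Sum>t\<in>D. (g t)\<^sup>2) = real (card D) * v"
  shows "(\<Sum>x\<in>PiE I (\<lambda>_. D). (\<Sum>i\<in>I. g (x i))\<^sup>2) =
      real (card D) ^ card I * (real (card I) * v)"
  using \<open>finite I\<close>
proof (induction I rule: finite_induct)
  case (insert i I)
  let ?X = "PiE I (\<lambda>_. D)"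
  define S1 where "S1 = (\<Sum>x\<in>?X. \<Sum>j\<in>I. g (x j))"
  define S2 where "S2 = (\<Sum>x\<in>?X. (\<Sum>j\<in>I. g (x j))\<^sup>2)"
  have upd: "(\<Sum>j\<in>insert i I. g ((x(i := t)) j)) = g t + (\<Sum>j\<in>I. g (x j))" for x t
    using insert by (auto intro!: sum.cong)
  have "(\<Sum>x\<in>PiE (insert i I) (\<lambda>_. D). (\<Sum>j\<in>insert i I. g (x j))\<^sup>2) =
      (\<Sum>t\<in>D. \<Sum>x\<in>?X. (g t + (\<Sum>j\<in>I. g (x j)))\<^sup>2)"
    unfolding sum_PiE_insert[OF insert(2)] upd ..
  also have "\<dots> = (\<Sum>t\<in>D. real (card ?X) * (g t)\<^sup>2 + 2 * S1 * g t + S2)"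
    by (simp add: S1_def S2_def power2_sum sum.distrib sum_distrib_left sum_distrib_right mult_ac)
  also have "\<dots> = real (card ?X) * (\<Sum>t\<in>D. (g t)\<^sup>2) + 2 * S1 * (\<Sum>t\<in>D. g t) + real (card D) * S2"
    by (simp add: sum.distrib sum_distrib_left)
  also have "\<dots> = real (card D) ^ card (insert i I) * (real (card (insert i I)) * v)"
    using insert by (simp add: S2_def mean var card_PiE algebra_simps)
  finally show ?case .
qed simp

lemma power_sums:
  fixes h :: nat
  shows "(\<Sum>t\<le>h. real t) = real h * (real h + 1) / 2"
    and "(\<Sum>t\<le>h. real t ^ 2) = real h * (real h + 1) * (2 * real h + 1) / 6"
    and "(\<Sum>t\<le>h. real t ^ 3) = (real h * (real h + 1) / 2) ^ 2"
    and "(\<Sum>t\<le>h. real t ^ 4) =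
      real h * (real h + 1) * (2 * real h + 1) * (3 * real h ^ 2 + 3 * real h - 1) / 30"
  by (induction h) (simp_all add: field_simps eval_nat_numeral)

lemma sum_int_atLeastAtMost: "(\<Sum>t\<in>{0..int h}. G t) = (\<Sum>t\<le>h. G (int t))"
  by (rule sum.reindex_bij_betw[symmetric], rule bij_betwI[where g = nat]) auto

lemma parabola_moments:
  fixes h :: nat
  defines "c \<equiv> real h * (real h - 1) / 6"
  shows "(\<Sum>t\<in>{0..int h}. real_of_int (t * (int h - t)) - c) = 0"
    and "(\<Sum>t\<in>{0..int h}. (real_of_int (t * (int h - t)) - c)\<^sup>2) =
      real (card {0..int h}) * (sigma (2 * h))\<^sup>2"
proof -
  have "(\<Sum>t\<in>{0..int h}. real_of_int (t * (int h - t)) - c) =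
      real h * (\<Sum>t\<le>h. real t) - (\<Sum>t\<le>h. real t ^ 2) - (real h + 1) * c"
    by (simp add: sum_int_atLeastAtMost sum_subtractf sum.distrib sum_distrib_left algebra_simps
        power2_eq_square)
  also have "\<dots> = 0"
    unfolding power_sums c_def by (simp add: field_simps)
  finally show "(\<Sum>t\<in>{0..int h}. real_of_int (t * (int h - t)) - c) = 0" .

  \<comment> \<open>Squaring \<open>sigma\<close> removes the root only if the radicand is
    nonnegative. Expanded in \<open>k = h - 1\<close>, it has nonnegative coefficients.\<close>
  have nonneg: "real (2 * h) ^ 4 + 8 * real (2 * h) ^ 3 + 4 * real (2 * h) ^ 2 - 48 * real (2 * h) \<ge> 0"
  proof (cases h)
    case (Suc k)
    then show ?thesis by (simp add: eval_nat_numeral algebra_simps)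
  qed simp
  have "(\<Sum>t\<in>{0..int h}. (real_of_int (t * (int h - t)) - c)\<^sup>2) =
      (real h) ^ 2 * (\<Sum>t\<le>h. real t ^ 2) - 2 * real h * (\<Sum>t\<le>h. real t ^ 3)
      + (\<Sum>t\<le>h. real t ^ 4) - 2 * c * (real h * (\<Sum>t\<le>h. real t) - (\<Sum>t\<le>h. real t ^ 2))
      + (\<Sum>t\<le>h. c\<^sup>2)"
    unfolding sum_int_atLeastAtMost sum_distrib_left sum_subtractf[symmetric] sum.distrib[symmetric]
    by (rule sum.cong) (simp_all add: algebra_simps eval_nat_numeral)
  also have "\<dots> = (real h + 1) * ((real (2 * h) ^ 4 + 8 * real (2 * h) ^ 3
      + 4 * real (2 * h) ^ 2 - 48 * real (2 * h)) / 2880)"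
    unfolding power_sums c_def by (simp add: field_simps eval_nat_numeral)
  also have "\<dots> = real (card {0..int h}) * (sigma (2 * h))\<^sup>2"
    using nonneg by (simp add: sigma_def)
  finally show "(\<Sum>t\<in>{0..int h}. (real_of_int (t * (int h - t)) - c)\<^sup>2) =
      real (card {0..int h}) * (sigma (2 * h))\<^sup>2" .
qed

text \<open>At \<open>m = 4\<close> the radicand is \<open>640 / 2880 = 2/9\<close>, and in powers
  of \<open>m - 4\<close> its other coefficients are positive. This is the threshold required by
  \<open>popular_value\<close>.\<close>

lemma sigma_ge:
  assumes "m \<ge> 4"
  shows "sigma m \<ge> sqrt (2/9)"
proof -
  obtain k where "m = 4 + k" using assms le_Suc_ex by blast
  then have "real m ^ 4 + 8 * real m ^ 3 + 4 * real m ^ 2 - 48 * real m \<ge> 640"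
    by (simp add: eval_nat_numeral algebra_simps)
  then show ?thesis unfolding sigma_def by (intro real_sqrt_le_mono) simp
qed

lemma sigma_pos: "m \<ge> 4 \<Longrightarrow> sigma m > 0"
  by (rule less_le_trans[OF _ sigma_ge]) simp_all

lemma sigma_sq_ge: "m \<ge> 4 \<Longrightarrow> (sigma m)\<^sup>2 \<ge> 2/9"
  using power_mono[OF sigma_ge, of m 2] by simp

section \<open>Concavity and progressions modulo \<open>2 * h\<close>\<close>

text \<open>Since \<open>x + z - 2 * y\<close> lies between \<open>-2 * h\<close> and
  \<open>2 * h\<close>, wraparound forces all three entries to endpoints of \<open>{0..h}\<close>,
  where the parabola vanishes. Without wraparound the concavity defect is half of
  \<open>(x - z)\<^sup>2\<close>.\<close>

lemma concave_defect_mod: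
  fixes h x y z :: int
  assumes "h > 0" "{x, y, z} \<subseteq> {0..h}" and cong: "(x + z) mod (2 * h) = (2 * y) mod (2 * h)"
  shows "x * (h - x) + z * (h - z) \<le> 2 * (y * (h - y))"
    and "x * (h - x) + z * (h - z) = 2 * (y * (h - y)) \<Longrightarrow> x = z"
proof -
  have "2 * h dvd (x + z) - 2 * y"
    using cong mod_eq_dvd_iff by blast
  then obtain q where q: "x + z - 2 * y = 2 * h * q" by blast
  have "2 * h * q \<le> 2 * h * 1" "2 * h * (-1) \<le> 2 * h * q"
    using assms(2) by (auto simp flip: q)
  then have "q \<le> 1" "-1 \<le> q"
    using assms(1) by (simp_all only: mult_le_cancel_left_pos)
  then consider "q = 0" | "q = 1" | "q = -1" by linarith
  then have "x + z = 2 * y \<or> x = z \<and> x * (h - x) = 0 \<and> y * (h - y) = 0"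
  proof cases
    case 2
    then have "x = h" "z = h" "y = 0" using q assms(2) by auto
    then show ?thesis by simp
  next
    case 3
    then have "x = 0" "z = 0" "y = h" using q assms(2) by auto
    then show ?thesis by simp
  qed (use q in simp)
  moreover have "2 * (2 * (y * (h - y)) - (x * (h - x) + z * (h - z))) = (x - z)\<^sup>2"
    if "x + z = 2 * y"
  proof -
    have "z = 2 * y - x" using that by simp
    show ?thesis unfolding \<open>z = 2 * y - x\<close> by (simp add: power2_eq_square algebra_simps)
  qed
  ultimately have *: "x = z \<and> x * (h - x) = 0 \<and> y * (h - y) = 0 \<or>
      2 * (2 * (y * (h - y)) - (x * (h - x) + z * (h - z))) = (x - z)\<^sup>2"
    by blast
  from * show "x * (h - x) + z * (h - z) \<le> 2 * (y * (h - y))"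
  proof
    assume "2 * (2 * (y * (h - y)) - (x * (h - x) + z * (h - z))) = (x - z)\<^sup>2"
    then have "0 \<le> 2 * (2 * (y * (h - y)) - (x * (h - x) + z * (h - z)))"
      by (metis zero_le_power2)
    then show ?thesis by (simp only: zero_le_mult_iff) simp
  qed auto
  show "x = z" if "x * (h - x) + z * (h - z) = 2 * (y * (h - y))"
    using * that by auto
qed

lemma carrier_Zmod_power:
  "m > 0 \<Longrightarrow> carrier (Zmod_power m n) = (\<Pi>\<^sub>E i\<in>{..<n}. {0..<int m})"
  by (simp add: Zmod_power_def carrier_integer_mod_group)

lemma proper_ap_3_Zmod_powerE:
  assumes "m > 0" "proper_ap (Zmod_power m n) 3 xs"
  obtains x y z where "xs = [x, y, z]" "x \<noteq> z"
    "\<And>i. i < n \<Longrightarrow> (x i + z i) mod int m = (2 * y i) mod int m"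
proof -
  let ?G = "Zmod_power m n"
  obtain x d where xd: "x \<in> carrier ?G" "d \<in> carrier ?G"
    and xs: "xs = map (\<lambda>j. x \<otimes>\<^bsub>?G\<^esub> d [^]\<^bsub>?G\<^esub> j) [0..<3]" "distinct xs"
    using assms by (auto simp: proper_ap_def)
  interpret group ?G
    unfolding Zmod_power_def by (rule product_group) (rule group_integer_mod_group)
  have "xs = [x, x \<otimes>\<^bsub>?G\<^esub> d, x \<otimes>\<^bsub>?G\<^esub> (d \<otimes>\<^bsub>?G\<^esub> d)]"
    using xd xs by (simp add: upt_rec numeral_2_eq_2)
  moreover have "(x i + (x \<otimes>\<^bsub>?G\<^esub> (d \<otimes>\<^bsub>?G\<^esub> d)) i) mod int m =
      (2 * (x \<otimes>\<^bsub>?G\<^esub> d) i) mod int m" if "i < n" for i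
  proof -
    have "(x i + (x i + (d i + d i) mod int m) mod int m) mod int m = 
       (2 * ((x i + d i) mod int m)) mod int m"
      by (simp add: mod_simps algebra_simps)
    then show ?thesis
      using that \<open>m > 0\<close> by (simp add: Zmod_power_def mult_integer_mod_group)
  qed
  ultimately show thesis
    using that xs(2) by simp
qed

text \<open>The coordinatewise defects \<open>e i\<close> are nonnegative and add up to
  \<open>2 * s - (s + s) = 0\<close>, so each vanishes. The outer terms of the progression then
  coincide, against properness.\<close>

lemma proper_ap_free_level_set:
  assumes "h > 0"
  shows "proper_ap_free (Zmod_power (2 * h) n) 3
     {x \<in> PiE {..<n} (\<lambda>_. {0..int h}). (\<Sum>i<n. x i * (int h - x i)) = s}"
  unfolding proper_ap_free_def
proof (intro notI, elim exE conjE)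
  let ?F = "\<lambda>x. \<Sum>i<n. x i * (int h - x i)"
  let ?S = "{x \<in> PiE {..<n} (\<lambda>_. {0..int h}). ?F x = s}"
  fix xs assume ap: "proper_ap (Zmod_power (2 * h) n) 3 xs" and sub: "set xs \<subseteq> ?S"
  obtain x y z where xyz: "xs = [x, y, z]" "x \<noteq> z"
    and cong: "\<And>i. i < n \<Longrightarrow> (x i + z i) mod int (2 * h) = (2 * y i) mod int (2 * h)"
    using proper_ap_3_Zmod_powerE[OF _ ap] assms by auto
  have S: "x \<in> ?S" "y \<in> ?S" "z \<in> ?S" using sub xyz by auto
  define e where "e i = 2 * (y i * (int h - y i)) - (x i * (int h - x i) + z i * (int h - z i))" for i
  have coord: "{x i, y i, z i} \<subseteq> {0..int h}" if "i < n" for i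
  proof -
    have "u i \<in> {0..int h}" if "u \<in> ?S" for u
      using that \<open>i < n\<close> PiE_mem[of u "{..<n}" "\<lambda>_. {0..int h}" i] by simp
    then show ?thesis using S by simp
  qed
  note defect = concave_defect_mod[OF _ coord cong[simplified of_nat_mult of_nat_numeral]]
  have e_nonneg: "e i \<ge> 0" if "i < n" for i
    using defect(1)[OF _ that that] assms by (simp add: e_def)
  have "(\<Sum>i<n. e i) = 2 * ?F y - (?F x + ?F z)"
    unfolding e_def sum_subtractf sum.distrib sum_distrib_left ..
  also have "\<dots> = 0" using S by simp
  finally have e_0: "e i = 0" if "i < n" for i
    using that e_nonneg sum_nonneg_eq_0_iff[of "{..<n}" e] by simp
  have "x i = z i" if "i < n" for i
    using defect(2)[OF _ that that] e_0[OF that] assms by (simp add: e_def)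
  moreover have "x \<in> PiE {..<n} (\<lambda>_. {0..int h})" "z \<in> PiE {..<n} (\<lambda>_. {0..int h})"
    using S by simp_all
  ultimately have "x = z"
    by (intro PiE_ext) auto
  with xyz show False by simp
qed

section \<open>The lower bound\<close>

lemma card_le_r_ap:
  assumes "finite (carrier G)" "S \<subseteq> carrier G" "proper_ap_free G k S"
  shows "card S \<le> r_ap k G"
  unfolding r_ap_def
proof (rule Max_ge)
  have "{card S |S. S \<subseteq> carrier G \<and> proper_ap_free G k S} \<subseteq> card ` Pow (carrier G)"
    by auto
  then show "finite {card S |S. S \<subseteq> carrier G \<and> proper_ap_free G k S}"
    using assms(1) finite_subset by blast
qed (use assms in auto)

lemma r_ap_3_Zmod_power_ge:
  assumes "m \<ge> 4" "even m" "n \<ge> 1"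
  shows "real (r_ap 3 (Zmod_power m n)) \<ge>
    (1 / (3 * sqrt 3 * sigma m)) / sqrt (real n) * ((real m + 2) / 2) ^ n"
proof -
  obtain h where m: "m = 2 * h" using assms(2) by blast
  then have h: "h \<ge> 2" using assms(1) by simp
  define D where "D = {0..int h}"
  define X where "X = PiE {..<n} (\<lambda>_. D)"
  define F where "F x = (\<Sum>i<n. x i * (int h - x i))" for x
  define c where "c = real h * (real h - 1) / 6"
  have cardX: "real (card X) = ((real m + 2) / 2) ^ n"
    by (simp add: X_def D_def card_PiE m add_divide_distrib add.commute)
  have "(\<Sum>x\<in>X. (\<Sum>i<n. real_of_int (x i * (int h - x i)) - c)\<^sup>2) =
      real (card D) ^ card {..<n} * (real (card {..<n}) * (sigma m)\<^sup>2)"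
    unfolding X_def D_def c_def m
    by (rule variance_sum_PiE) (simp_all only: parabola_moments finite_lessThan finite_atLeastAtMost_int)
  also have "real (card D) ^ card {..<n} = real (card X)"
    by (simp add: X_def card_PiE)
  finally have var: "(\<Sum>x\<in>X. (real_of_int (F x) - real n * c)\<^sup>2) = real (card X) * (real n * (sigma m)\<^sup>2)"
    by (simp add: F_def sum_subtractf)
  \<comment> \<open>The variance over the box is at least that of a single coordinate, so the
    threshold holds for every \<open>n \<ge> 1\<close>.\<close>
  have "1 * (2/9) \<le> real n * (sigma m)\<^sup>2"
    using assms sigma_sq_ge by (intro mult_mono) auto
  moreover have "finite X"
    by (auto simp: X_def D_def intro: finite_PiE)
  ultimately obtain s where
    s: "real (card X) / (3 * sqrt 3 * sqrt (real n * (sigma m)\<^sup>2)) \<le> real (card {x\<in>X. F x = s})"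
    using popular_value[OF _ _ var] by auto
  have "card {x\<in>X. F x = s} \<le> r_ap 3 (Zmod_power m n)"
  proof (rule card_le_r_ap)
    show "proper_ap_free (Zmod_power m n) 3 {x \<in> X. F x = s}"
      using proper_ap_free_level_set[of h n s] h by (simp add: X_def D_def F_def m)
    show "finite (carrier (Zmod_power m n))"
      using assms by (auto simp: carrier_Zmod_power intro: finite_PiE)
    \<comment> \<open>Here \<open>h < 2 * h = m\<close>, so entries in \<open>{0..h}\<close> are
      reduced residues.\<close>
    have "X \<subseteq> carrier (Zmod_power m n)"
      using h by (auto simp: X_def D_def m carrier_Zmod_power intro!: PiE_mono)
    then show "{x \<in> X. F x = s} \<subseteq> carrier (Zmod_power m n)" by blast
  qed
  moreover have "real (card X) / (3 * sqrt 3 * sqrt (real n * (sigma m)\<^sup>2)) =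
      (1 / (3 * sqrt 3 * sigma m)) / sqrt (real n) * ((real m + 2) / 2) ^ n"
    using sigma_pos[OF assms(1)] by (simp add: real_sqrt_mult cardX)
  ultimately show ?thesis using s by linarith
qed

section \<open>Asymptotics of the constant\<close>

text \<open>The quartic under the root is asymptotic to \<open>m^4\<close>, and
  \<open>sqrt 2880 = 24 * sqrt 5\<close> divided by 3 gives the factor
  \<open>8 * sqrt 5\<close>.\<close>

lemma constant_asymp_equiv:
  "(\<lambda>m::nat. 1 / (3 * sqrt 3 * sigma m)) \<sim>[at_top] (\<lambda>m. 8 * sqrt 5 / (sqrt 3 * (real m)\<^sup>2))"
proof -
  have "sqrt (2880::real) = 24 * sqrt 5"
    by (rule real_sqrt_unique) (simp_all add: power2_eq_square)
  then have sig: "sigma m = sqrt (real m ^ 4 + 8 * real m ^ 3 + 4 * real m ^ 2 - 48 * real m) / (24 * sqrt 5)" for m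
    by (simp add: sigma_def real_sqrt_divide)
  have "(\<lambda>m::nat. 1 / sqrt (real m ^ 4 + 8 * real m ^ 3 + 4 * real m ^ 2 - 48 * real m))
      \<sim>[at_top] (\<lambda>m. 1 / (real m)\<^sup>2)"
    by real_asymp
  then have "(\<lambda>m::nat. 8 * sqrt 5 / sqrt 3 * (1 / sqrt (real m ^ 4 + 8 * real m ^ 3 + 4 * real m ^ 2 - 48 * real m)))
      \<sim>[at_top] (\<lambda>m. 8 * sqrt 5 / sqrt 3 * (1 / (real m)\<^sup>2))"
    by (rule asymp_equiv_mult[OF asymp_equiv_refl])
  then show ?thesis by (simp add: sig)
qed

theorem theorem3p11:
  shows "(\<forall>m::nat. m \<ge> 4 \<and> even m \<longrightarrow>
            (\<exists>C::real. C > 0 \<and>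
               (\<forall>n::nat. n \<ge> 1 \<longrightarrow>
                  real (r_ap 3 (Zmod_power m n)) \<ge> C / sqrt (real n) * ((real m + 2) / 2) ^ n)))
       \<and> (\<forall>m::nat. m \<ge> 4 \<and> even m \<longrightarrow>
            1 / (3 * sqrt 3 * sigma m) > 0 \<and>
            (\<forall>n::nat. n \<ge> 1 \<longrightarrow>
               real (r_ap 3 (Zmod_power m n)) \<ge>
                 (1 / (3 * sqrt 3 * sigma m)) / sqrt (real n) * ((real m + 2) / 2) ^ n))
       \<and> (\<lambda>m::nat. 1 / (3 * sqrt 3 * sigma m))
            \<sim>[inf at_top (principal {m. even m})]
          (\<lambda>m::nat. 8 * sqrt 5 / (sqrt 3 * (real m)\<^sup>2))"
proof -
  have pos: "1 / (3 * sqrt 3 * sigma m) > 0" if "m \<ge> 4" for m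
    using sigma_pos[OF that] by simp
  show ?thesis
  proof (intro conjI allI impI; (elim conjE)?)
    fix m :: nat assume "m \<ge> 4" "even m"
    then show "\<exists>C>0. \<forall>n\<ge>1. real (r_ap 3 (Zmod_power m n)) \<ge> C / sqrt (real n) * ((real m + 2) / 2) ^ n"
      using pos r_ap_3_Zmod_power_ge by blast
  next
    show "(\<lambda>m::nat. 1 / (3 * sqrt 3 * sigma m)) \<sim>[inf at_top (principal {m. even m})]
        (\<lambda>m::nat. 8 * sqrt 5 / (sqrt 3 * (real m)\<^sup>2))"
      \<comment> \<open>The limit over all \<open>m\<close> passes to the finer filter of even
        \<open>m\<close>.\<close>
      using constant_asymp_equiv unfolding asymp_equiv_def by (rule tendsto_mono[OF inf_le1])
  qed (use pos r_ap_3_Zmod_power_ge in auto)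
qed

end
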